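(* Let $-\infty<R<\infty$ and let $p:\mathbb{R}\to[0,\infty)$ be a probability density function with support $(-\infty,R]$ and distribution function $P$, satisfying the following conditions. (i) $p$ is continuous and positive on $(-\infty,R)$, and there are finitely many points $-\infty<y_1<\dots<y_m<R$ ($m\ge 0$) such that $p$ is continuously differentiable on each component interval of $S(p)=(-\infty,R)\setminus\{y_1,\dots,y_m\}$. (ii) $\sup_{x\in S(p)}\left|\frac{p'(x)\min\{P(x),1-P(x)\}}{p^2(x)}\right|<\infty$. (iii) $\int_{S(p)}(1+|x|)\,|p'(x)|\,\mathrm{d}x<\infty$. (iv) $\lim_{x\nearrow R}\frac{1-P(x)}{p(x)}=0$. Let $X:\Omega\to(-\infty,R)$ be a random variable with $\mathbb{P}(X\in S(p))=1$, $\mathbb{E}\left|\frac{p'(X)}{p(X)}\right|<\infty$ and $\mathbb{E}\left|\frac{p'(X)}{p(X)}X\right|<\infty$. Then $X$ has Lebesgue density $p$ if, and only if, the distribution function $F_X$ of $X$ satisfies $$1-F_X(t)=\mathbb{E}\left[\frac{p'(X)}{p(X)}\Big(R-\max\{X,t\}\Big)\right],\quad t<R.$$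
   Context: $(\Omega,\mathcal{A},\mathbb{P})$ is a probability space. $F_X(t)=\mathbb{P}(X\le t)$ is the distribution function of $X$. "$X$ has Lebesgue density $p$" means that the law of $X$ is $p\,\mathcal{L}^1$, where $\mathcal{L}^1$ is Lebesgue measure on $\mathbb{R}$. $P(x)=\int_{-\infty}^x p(s)\,\mathrm{d}s$. The case $m=0$ is allowed. *)

theory Defs
  imports "HOL-Probability.Probability"
begin

definition prob_density :: "(real \<Rightarrow> real) \<Rightarrow> bool" where
  "prob_density p \<longleftrightarrow>
     p \<in> borel_measurable borel \<and> (\<forall>x. 0 \<le> p x) \<and> (\<integral>\<^sup>+ x. ennreal (p x) \<partial>lborel) = 1"

definition density_support :: "(real \<Rightarrow> real) \<Rightarrow> real set" where
  "density_support p = closure {x. p x > 0}"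

definition dens_cdf :: "(real \<Rightarrow> real) \<Rightarrow> real \<Rightarrow> real" where
  "dens_cdf p x = (LBINT s:{..x}. p s)"

text \<open>The set \<open>S(p)\<close>; the exceptional points are \<open>y 1, \<dots>, y m\<close>, and \<open>m = 0\<close> gives \<open>{..<R}\<close>.\<close>

definition reg_set :: "real \<Rightarrow> nat \<Rightarrow> (nat \<Rightarrow> real) \<Rightarrow> real set" where
  "reg_set R m y = {..<R} - y ` {1..m}"

end

theory Submission
  imports Defs
begin

text \<open>
  Write \<open>g = p' / p\<close> and consider, for the given random variable \<open>X\<close> with distribution function
  \<open>F\<close>, the two functions
  \<open>h t = E[g(X); X \<le> t]\<close> and \<open>V t = E[g(X) (R - max X t)]\<close>.
  The theorem asserts that \<open>X\<close> has density \<open>p\<close> iff \<open>1 - F = V\<close> on the left of \<open>R\<close>. Two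
  differentiation rules, valid for arbitrary laws of \<open>X\<close>, carry the proof in both directions:

  \<^item> \<open>V' = - h\<close> at every point that is not an atom of \<open>X\<close> (\<open>max_integral_has_derivative\<close>);
  \<^item> \<open>h' = g F'\<close> at every point where \<open>g\<close> is continuous and \<open>F\<close> is differentiable
    (\<open>truncated_integral_has_derivative\<close>).

  If \<open>X\<close> has density \<open>p\<close>, then \<open>F' = p\<close>, so \<open>h' = p'\<close> off finitely many points and
  \<open>h - p\<close> is constant. Because \<open>h\<close> vanishes at \<open>-\<infinity>\<close> and the only limit a density can have
  there is \<open>0\<close>, the constant is \<open>0\<close>. So \<open>V' = -p = (1 - F)'\<close>, and as \<open>V\<close> and \<open>1 - F\<close> both
  vanish at \<open>R\<close>, they agree.

  Conversely, \<open>F = 1 - V\<close> is continuous, so \<open>X\<close> has no atoms and \<open>F' = h\<close>. The second rule now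
  is the differential equation \<open>h' = (p' / p) h\<close>, whose solutions are the multiples \<open>h = c p\<close>
  (\<open>log_derivative_equation_unique\<close>). So \<open>F - c P\<close> is constant, and its values at \<open>R\<close> and limit
  at \<open>-\<infinity>\<close> give \<open>c = 1\<close> and \<open>F = P\<close>.

  Differentiating the integrals directly is what allows the exceptional points \<open>y i\<close> to be handled
  by continuity alone: a continuous function whose derivative is zero off a finite set is constant.
\<close>

section \<open>Integrals over the events X \<le> t\<close>

lemma truncated_integral_continuous:
  fixes G X :: "'a \<Rightarrow> real"
  assumes X [measurable]: "X \<in> borel_measurable N" and G: "integrable N G"
    and no_atom: "AE w in N. X w \<noteq> s"
  shows "isCont (\<lambda>t. \<integral>w. G w * indicator {..t} (X w) \<partial>N) s"
proof (rule continuous_at_sequentiallyI)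
  fix u :: "nat \<Rightarrow> real" assume u: "u \<longlonglongrightarrow> s"
  note [measurable] = borel_measurable_integrable[OF G]
  show "(\<lambda>n. \<integral>w. G w * indicator {..u n} (X w) \<partial>N) \<longlonglongrightarrow> (\<integral>w. G w * indicator {..s} (X w) \<partial>N)"
  proof (rule integral_dominated_convergence[where w="\<lambda>w. \<bar>G w\<bar>"])
    show "AE w in N. (\<lambda>n. G w * indicator {..u n} (X w)) \<longlonglongrightarrow> G w * indicator {..s} (X w)"
      using no_atom
    proof (rule AE_mp, intro AE_I2 impI)
      fix w assume "X w \<noteq> s"
      then have "\<forall>\<^sub>F n in sequentially. indicator {..s} (X w) = (indicator {..u n} (X w) :: real)"
        using order_tendstoD[OF u, of "X w"] 
        by (cases "X w < s") (auto elim!: eventually_mono simp: indicator_def)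
      then have "(\<lambda>n. indicator {..u n} (X w)) \<longlonglongrightarrow> (indicator {..s} (X w) :: real)"
        by (rule tendsto_eventually[OF eventually_mono]) simp
      then show "(\<lambda>n. G w * indicator {..u n} (X w)) \<longlonglongrightarrow> G w * indicator {..s} (X w)"
        by (intro tendsto_mult tendsto_const)
    qed
  qed (use G in \<open>auto simp: indicator_def\<close>)
qed

lemma truncated_integral_at_bot:
  fixes G X :: "'a \<Rightarrow> real"
  assumes X [measurable]: "X \<in> borel_measurable N" and G: "integrable N G"
  shows "((\<lambda>t. \<integral>w. G w * indicator {..t} (X w) \<partial>N) \<longlongrightarrow> 0) at_bot"
proof -
  note [measurable] = borel_measurable_integrable[OF G]
  have "((\<lambda>t. \<integral>w. G w * indicator {..-t} (X w) \<partial>N) \<longlongrightarrow> (\<integral>w. 0 \<partial>N)) at_top"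
  proof (rule integral_dominated_convergence_at_top[where w="\<lambda>w. \<bar>G w\<bar>"])
    have "\<forall>\<^sub>F t in at_top. G w * indicator {..-t} (X w) = 0" for w
      using eventually_gt_at_top[of "- X w"] by eventually_elim (auto simp: indicator_def)
    then show "AE w in N. ((\<lambda>t. G w * indicator {..-t} (X w)) \<longlongrightarrow> 0) at_top"
      by (intro AE_I2 tendsto_eventually)
  qed (use G in \<open>auto simp: indicator_def\<close>)
  then show ?thesis
    by (simp add: filterlim_at_bot_mirror)
qed

text \<open>
  Increments of the integral are \<open>\<integral> g dF\<close> over \<open>{s<..x}\<close>, and continuity of \<open>g\<close> at \<open>s\<close> makes
  this \<open>g s (F x - F s)\<close> up to a small multiple of \<open>F x - F s\<close>. The distribution function enters
  only through its increments so that the rule also covers Lebesgue measure with \<open>F x = x\<close>, where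
  it is the fundamental theorem of calculus.
\<close>

lemma truncated_integral_has_derivative:
  fixes X :: "'a \<Rightarrow> real" and g F :: "real \<Rightarrow> real"
  assumes X [measurable]: "X \<in> borel_measurable N" and g: "integrable N (\<lambda>w. g (X w))"
    and F: "mono F"
    and incr: "\<And>a b. a \<le> b \<Longrightarrow>
      emeasure N {w \<in> space N. a < X w \<and> X w \<le> b} = ennreal (F b - F a)"
    and cont: "isCont g s" and deriv: "(F has_real_derivative D) (at s)"
  shows "((\<lambda>t. \<integral>w. g (X w) * indicator {..t} (X w) \<partial>N) has_real_derivative g s * D) (at s)"
proof -
  note [measurable] = borel_measurable_integrable[OF g]
  define h where "h t = (\<integral>w. g (X w) * indicator {..t} (X w) \<partial>N)" for t
  have int_h: "integrable N (\<lambda>w. g (X w) * indicator {..t} (X w))" for t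
    by (rule Bochner_Integration.integrable_bound[OF g]) (auto simp: indicator_def)
  have bound: "\<bar>h b - h a - g s * (F b - F a)\<bar> \<le> e * (F b - F a)"
    if ab: "a \<le> b" and near: "\<And>x. a < x \<Longrightarrow> x \<le> b \<Longrightarrow> \<bar>g x - g s\<bar> \<le> e" for a b e
  proof -
    define A where "A = {w \<in> space N. a < X w \<and> X w \<le> b}"
    have A [measurable]: "A \<in> sets N" unfolding A_def by measurable
    have emA: "emeasure N A = ennreal (F b - F a)" using incr[OF ab] by (simp add: A_def)
    have meA: "measure N A = F b - F a"
      using emA monoD[OF F ab] by (simp add: measure_def)
    have iA: "integrable N (\<lambda>w. c * indicator A w :: real)" for c
      using A emA by (intro integrable_mult_right integrable_real_indicator) auto
    have igA: "integrable N (\<lambda>w. g (X w) * indicator A w)"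
      by (rule Bochner_Integration.integrable_bound[OF g]) (auto simp: indicator_def)
    have "h b - h a = (\<integral>w. g (X w) * indicator {..b} (X w) - g (X w) * indicator {..a} (X w) \<partial>N)"
      unfolding h_def by (rule Bochner_Integration.integral_diff[symmetric]) (rule int_h)+
    also have "\<dots> = (\<integral>w. g (X w) * indicator A w \<partial>N)"
      using ab by (intro Bochner_Integration.integral_cong) (auto simp: A_def indicator_def)
    finally have "h b - h a - g s * (F b - F a)
        = (\<integral>w. g (X w) * indicator A w \<partial>N) - (\<integral>w. g s * indicator A w \<partial>N)"
      using meA A by (simp add: Int_absorb2 sets.sets_into_space)
    also have "\<dots> = (\<integral>w. g (X w) * indicator A w - g s * indicator A w \<partial>N)"
      by (rule Bochner_Integration.integral_diff[symmetric]) (rule igA iA)+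
    also have "\<bar>\<dots>\<bar> \<le> (\<integral>w. \<bar>g (X w) * indicator A w - g s * indicator A w\<bar> \<partial>N)"
      by (rule integral_abs_bound)
    also have "\<dots> \<le> (\<integral>w. e * indicator A w \<partial>N)"
      using near by (intro integral_mono integrable_abs Bochner_Integration.integrable_diff igA iA)
         (auto simp: A_def indicator_def)
    also have "\<dots> = e * (F b - F a)"
      using meA A by (simp add: Int_absorb2 sets.sets_into_space)
    finally show ?thesis .
  qed
  have "(\<lambda>x. (h x - h s) / (x - s) - g s * ((F x - F s) / (x - s))) \<midarrow>s\<rightarrow> 0"
  proof (rule tendstoI)
    fix e :: real assume "0 < e"
    \<comment> \<open>Difference quotients of \<open>F\<close> are eventually below \<open>\<bar>D\<bar> + 1\<close>, so an error of \<open>d\<close> in \<open>g\<close>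
      costs at most \<open>e\<close>.\<close>
    define d where "d = e / (\<bar>D\<bar> + 1)"
    have "0 < d" using \<open>0 < e\<close> by (simp add: d_def)
    then obtain r where r: "0 < r" "\<And>x. \<bar>x - s\<bar> < r \<Longrightarrow> \<bar>g x - g s\<bar> < d"
      using cont unfolding continuous_at_eps_delta dist_real_def by blast
    have "((\<lambda>x. \<bar>(F x - F s) / (x - s)\<bar>) \<longlongrightarrow> \<bar>D\<bar>) (at s)"
      using deriv unfolding has_field_derivative_iff by (rule tendsto_rabs)
    then have "\<forall>\<^sub>F x in at s. \<bar>(F x - F s) / (x - s)\<bar> < \<bar>D\<bar> + 1"
      by (rule order_tendstoD) simp
    moreover have "\<forall>\<^sub>F x in at s. \<bar>x - s\<bar> < r"
      using r(1) eventually_at[of "\<lambda>x. \<bar>x - s\<bar> < r" s UNIV] by (auto simp: dist_real_def)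
    moreover have "\<forall>\<^sub>F x in at s. x \<noteq> s" by (simp add: eventually_at_filter)
    ultimately show "\<forall>\<^sub>F x in at s.
        dist ((h x - h s) / (x - s) - g s * ((F x - F s) / (x - s))) 0 < e"
    proof eventually_elim
      case (elim x)
      have "\<bar>h x - h s - g s * (F x - F s)\<bar> \<le> d * \<bar>F x - F s\<bar>"
      proof (cases "s \<le> x")
        case True
        then show ?thesis
          using bound[of s x d] r(2) elim(2) monoD[OF F True] by (force simp: less_imp_le)
      next
        case False
        then have "x \<le> s" by simp
        then have "\<bar>h s - h x - g s * (F s - F x)\<bar> \<le> d * (F s - F x)"
          using r(2) elim(2) by (intro bound) (auto intro!: less_imp_le)
        then show ?thesis
          using monoD[OF F \<open>x \<le> s\<close>]
          by (simp add: abs_minus_commute[of "h x - h s"] abs_minus_commute[of "F x"] right_diff_distrib)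
      qed
      then have "\<bar>h x - h s - g s * (F x - F s)\<bar> / \<bar>x - s\<bar> \<le> d * \<bar>F x - F s\<bar> / \<bar>x - s\<bar>"
        by (rule divide_right_mono) simp
      also have "\<dots> = d * \<bar>(F x - F s) / (x - s)\<bar>" by simp
      also have "\<dots> < d * (\<bar>D\<bar> + 1)"
        using elim(1) \<open>0 < d\<close> by (rule mult_strict_left_mono)
      also have "\<dots> = e" by (simp add: d_def)
      finally show ?case
        by (simp add: dist_real_def diff_divide_distrib right_diff_distrib flip: abs_divide)
    qed
  qed
  moreover have "(\<lambda>x. g s * ((F x - F s) / (x - s))) \<midarrow>s\<rightarrow> g s * D"
    using deriv unfolding has_field_derivative_iff by (intro tendsto_mult tendsto_const)
  ultimately have "(\<lambda>x. ((h x - h s) / (x - s) - g s * ((F x - F s) / (x - s)))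
      + g s * ((F x - F s) / (x - s))) \<midarrow>s\<rightarrow> 0 + g s * D"
    by (rule tendsto_add)
  then show ?thesis
    unfolding has_field_derivative_iff h_def by simp
qed

section \<open>Integrals of R - max X t\<close>

lemma integrable_mult_max:
  fixes G X :: "'a \<Rightarrow> real"
  assumes X [measurable]: "X \<in> borel_measurable N"
    and G: "integrable N G" and GX: "integrable N (\<lambda>w. G w * X w)"
  shows "integrable N (\<lambda>w. G w * (R - max (X w) t))"
proof -
  note [measurable] = borel_measurable_integrable[OF G]
  have "integrable N (\<lambda>w. (\<bar>R\<bar> + \<bar>t\<bar>) * \<bar>G w\<bar> + \<bar>G w * X w\<bar>)"
    using G GX by auto
  then show ?thesis
  proof (rule Bochner_Integration.integrable_bound)
    show "AE w in N. norm (G w * (R - max (X w) t))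
        \<le> norm ((\<bar>R\<bar> + \<bar>t\<bar>) * \<bar>G w\<bar> + \<bar>G w * X w\<bar>)"
    proof (rule AE_I2)
      fix w
      have "\<bar>R - max (X w) t\<bar> \<le> \<bar>R\<bar> + \<bar>t\<bar> + \<bar>X w\<bar>" by linarith
      then have "norm (G w * (R - max (X w) t)) \<le> \<bar>G w\<bar> * (\<bar>R\<bar> + \<bar>t\<bar> + \<bar>X w\<bar>)"
        unfolding real_norm_def abs_mult by (rule mult_left_mono) simp
      also have "\<dots> = norm ((\<bar>R\<bar> + \<bar>t\<bar>) * \<bar>G w\<bar> + \<bar>G w * X w\<bar>)"
        by (simp add: abs_mult algebra_simps)
      finally show "norm (G w * (R - max (X w) t)) \<le> norm ((\<bar>R\<bar> + \<bar>t\<bar>) * \<bar>G w\<bar> + \<bar>G w * X w\<bar>)" .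
    qed
  qed simp
qed

text \<open>
  The map \<open>t \<mapsto> max (X w) t\<close> is 1-Lipschitz, so the integral is Lipschitz with constant
  \<open>\<integral> \<bar>G\<bar>\<close>. This gives continuity of the distribution function before the absence of atoms is
  known.
\<close>

lemma max_integral_continuous:
  fixes G X :: "'a \<Rightarrow> real"
  assumes X: "X \<in> borel_measurable N"
    and G: "integrable N G" and GX: "integrable N (\<lambda>w. G w * X w)"
  shows "isCont (\<lambda>t. \<integral>w. G w * (R - max (X w) t) \<partial>N) s"
proof -
  note int = integrable_mult_max[OF X G GX]
  define V where "V t = (\<integral>w. G w * (R - max (X w) t) \<partial>N)" for t
  have "\<bar>V x - V s\<bar> \<le> (\<integral>w. \<bar>G w\<bar> \<partial>N) * \<bar>x - s\<bar>" for x
  proof -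
    have "V x - V s = (\<integral>w. G w * (R - max (X w) x) - G w * (R - max (X w) s) \<partial>N)"
      unfolding V_def by (rule Bochner_Integration.integral_diff[symmetric]) (rule int)+
    also have "\<bar>\<dots>\<bar> \<le> (\<integral>w. \<bar>G w * (R - max (X w) x) - G w * (R - max (X w) s)\<bar> \<partial>N)"
      by (rule integral_abs_bound)
    also have "\<dots> \<le> (\<integral>w. \<bar>G w\<bar> * \<bar>x - s\<bar> \<partial>N)"
    proof (rule integral_mono)
      fix w
      have "\<bar>G w * (R - max (X w) x) - G w * (R - max (X w) s)\<bar>
          = \<bar>G w\<bar> * \<bar>max (X w) s - max (X w) x\<bar>"
        by (simp add: right_diff_distrib flip: abs_mult)
      also have "\<dots> \<le> \<bar>G w\<bar> * \<bar>x - s\<bar>" by (intro mult_left_mono) auto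
      finally show "\<bar>G w * (R - max (X w) x) - G w * (R - max (X w) s)\<bar> \<le> \<bar>G w\<bar> * \<bar>x - s\<bar>" .
    qed (use int G in auto)
    finally show ?thesis by simp
  qed
  then have "\<forall>\<^sub>F x in at s. norm (V x - V s) \<le> (\<integral>w. \<bar>G w\<bar> \<partial>N) * \<bar>x - s\<bar>"
    by (intro always_eventually allI) simp
  moreover have "((\<lambda>x. (\<integral>w. \<bar>G w\<bar> \<partial>N) * \<bar>x - s\<bar>) \<longlongrightarrow> 0) (at s)"
    by (auto intro!: tendsto_eq_intros)
  ultimately have "((\<lambda>x. V x - V s) \<longlongrightarrow> 0) (at s)"
    by (rule Lim_null_comparison)
  then show ?thesis
    unfolding isCont_def V_def[symmetric] by (simp add: LIM_zero_iff)
qed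

text \<open>
  The difference quotient of \<open>R - max (X w) t\<close> at \<open>s\<close> differs from \<open>- indicator {..s} (X w)\<close>
  only if \<open>X w\<close> lies between \<open>s\<close> and the nearby point \<open>x\<close>, and then by at most \<open>1\<close>. The error
  is thus at most the increment of the integral of \<open>\<bar>G\<bar>\<close> over \<open>X \<le> t\<close>, which is small when \<open>s\<close>
  is not an atom.
\<close>

lemma max_integral_has_derivative:
  fixes G X :: "'a \<Rightarrow> real"
  assumes X [measurable]: "X \<in> borel_measurable N"
    and G: "integrable N G" and GX: "integrable N (\<lambda>w. G w * X w)"
    and no_atom: "AE w in N. X w \<noteq> s"
  shows "((\<lambda>t. \<integral>w. G w * (R - max (X w) t) \<partial>N) has_real_derivative
      - (\<integral>w. G w * indicator {..s} (X w) \<partial>N)) (at s)"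
proof -
  note [measurable] = borel_measurable_integrable[OF G]
  note int = integrable_mult_max[OF X G GX]
  define V where "V t = (\<integral>w. G w * (R - max (X w) t) \<partial>N)" for t
  define h where "h = (\<integral>w. G w * indicator {..s} (X w) \<partial>N)"
  define k where "k t = (\<integral>w. \<bar>G w\<bar> * indicator {..t} (X w) \<partial>N)" for t
  have int_h: "integrable N (\<lambda>w. G w * indicator {..t} (X w))" for t
    by (rule Bochner_Integration.integrable_bound[OF G]) (auto simp: indicator_def)
  have int_k: "integrable N (\<lambda>w. \<bar>G w\<bar> * indicator {..t} (X w))" for t
    by (rule Bochner_Integration.integrable_bound[OF G]) (auto simp: indicator_def)
  have k: "(k \<longlongrightarrow> k s) (at s)"
    using truncated_integral_continuous[OF X integrable_abs[OF G] no_atom]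
    unfolding isCont_def k_def .
  have bound: "\<bar>V x - V s + (x - s) * h\<bar> \<le> \<bar>x - s\<bar> * \<bar>k x - k s\<bar>" for x
  proof -
    let ?D = "\<lambda>w. G w * (R - max (X w) x) - G w * (R - max (X w) s)
        + (x - s) * (G w * indicator {..s} (X w))"
    let ?K = "\<lambda>w. \<bar>G w\<bar> * indicator {..x} (X w) - \<bar>G w\<bar> * indicator {..s} (X w)"
    have D: "V x - V s + (x - s) * h = (\<integral>w. ?D w \<partial>N)"
      unfolding V_def h_def using int int_h by simp
    have "\<bar>V x - V s + (x - s) * h\<bar> \<le> (\<integral>w. \<bar>?D w\<bar> \<partial>N)"
      unfolding D by (rule integral_abs_bound)
    \<comment> \<open>\<open>x - s\<close> and \<open>?K w\<close> have the same sign, so their product is nonnegative on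
      both sides of \<open>s\<close>.\<close>
    also have "\<dots> \<le> (\<integral>w. (x - s) * ?K w \<partial>N)"
    proof (rule integral_mono)
      fix w
      let ?d = "(R - max (X w) x) - (R - max (X w) s) + (x - s) * indicator {..s} (X w)"
      have "\<bar>?D w\<bar> = \<bar>G w\<bar> * \<bar>?d\<bar>"
        unfolding abs_mult[symmetric] by (simp add: algebra_simps)
      also have "\<dots> \<le> \<bar>G w\<bar> * ((x - s) * (indicator {..x} (X w) - indicator {..s} (X w)))"
        by (rule mult_left_mono) (auto simp: indicator_def)
      finally show "\<bar>?D w\<bar> \<le> (x - s) * ?K w" by (simp add: algebra_simps)
    qed (use int int_h int_k in auto)
    also have "\<dots> = (x - s) * (k x - k s)"
      unfolding k_def using int_k by simp
    also have "\<dots> \<le> \<bar>x - s\<bar> * \<bar>k x - k s\<bar>"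
      by (simp flip: abs_mult)
    finally show ?thesis .
  qed
  have "((\<lambda>x. (V x - V s) / (x - s) + h) \<longlongrightarrow> 0) (at s)"
  proof (rule Lim_null_comparison)
    show "\<forall>\<^sub>F x in at s. norm ((V x - V s) / (x - s) + h) \<le> \<bar>k x - k s\<bar>"
      unfolding eventually_at_filter
    proof (intro always_eventually allI impI)
      fix x assume "x \<noteq> s"
      then have "(V x - V s) / (x - s) + h = (V x - V s + (x - s) * h) / (x - s)"
        by (simp add: field_simps)
      then show "norm ((V x - V s) / (x - s) + h) \<le> \<bar>k x - k s\<bar>"
        using bound[of x] \<open>x \<noteq> s\<close> by (simp add: abs_divide divide_le_eq mult.commute)
    qed
    show "((\<lambda>x. \<bar>k x - k s\<bar>) \<longlongrightarrow> 0) (at s)"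
      using k by (auto intro!: tendsto_eq_intros)
  qed
  from tendsto_diff[OF this tendsto_const[of h]]
  show ?thesis
    unfolding has_field_derivative_iff V_def[symmetric] h_def[symmetric] by simp
qed

section \<open>Densities and their logarithmic derivatives\<close>

text \<open>
  Components of an open set are open, so being continuously differentiable on each of them is a
  statement about all points of the set.
\<close>

lemma deriv_C1_on_components:
  fixes p :: "real \<Rightarrow> real"
  assumes S: "open S" and C1: "\<forall>C\<in>components S. p C1_differentiable_on C" and x: "x \<in> S"
  shows "(p has_real_derivative deriv p x) (at x)" and "isCont (deriv p) x"
proof -
  define C where "C = connected_component_set S x"
  have C: "open C" "x \<in> C" "C \<in> components S"
    using S x by (auto simp: C_def open_connected_component intro: componentsI)
  then obtain D where D: "\<And>z. z \<in> C \<Longrightarrow> (p has_real_derivative D z) (at z)"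
    and cont: "continuous_on C D"
    using C1 unfolding C1_differentiable_on_def has_real_derivative_iff_has_vector_derivative
    by blast
  have eq: "deriv p z = D z" if "z \<in> C" for z
    using D[OF that] by (rule DERIV_imp_deriv)
  show "(p has_real_derivative deriv p x) (at x)"
    using D C(2) eq by simp
  have "continuous_on C (deriv p)"
    using cont eq by (simp cong: continuous_on_cong)
  then show "isCont (deriv p) x"
    using C by (simp add: continuous_on_eq_continuous_at)
qed

text \<open>
  By the mean value theorem \<open>F t - F (t - 1)\<close> is a value of \<open>f\<close> far to the left, and it tends to
  \<open>L - L\<close>. Applied to a distribution function and its density, this excludes nonzero limits of the
  density at \<open>-\<infinity>\<close>.
\<close>

lemma derivative_limit_at_bot_eq_0:
  fixes F f :: "real \<Rightarrow> real"
  assumes F': "\<And>x. x < R \<Longrightarrow> (F has_real_derivative f x) (at x)"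
    and F: "(F \<longlongrightarrow> L) at_bot" and f: "(f \<longlongrightarrow> c) at_bot"
  shows "c = 0"
proof (rule ccontr)
  assume "c \<noteq> 0"
  then have e: "0 < \<bar>c\<bar> / 2" by simp
  from tendstoD[OF f this] obtain b where b: "\<And>x. x \<le> b \<Longrightarrow> \<bar>f x - c\<bar> < \<bar>c\<bar> / 2"
    by (auto simp: eventually_at_bot_linorder dist_real_def)
  have "filterlim (\<lambda>t::real. t - 1) at_bot at_bot"
    unfolding filterlim_at_bot
  proof
    fix Z :: real
    show "\<forall>\<^sub>F t in at_bot. t - 1 \<le> Z"
      using eventually_le_at_bot[of Z] by eventually_elim simp
  qed
  from tendsto_diff[OF F filterlim_compose[OF F this]]
  have "((\<lambda>t. F t - F (t - 1)) \<longlongrightarrow> 0) at_bot" by simp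
  from tendstoD[OF this e] obtain a where a: "\<And>t. t \<le> a \<Longrightarrow> \<bar>F t - F (t - 1)\<bar> < \<bar>c\<bar> / 2"
    by (auto simp: eventually_at_bot_linorder)
  define t where "t = min a (min b (R - 1))"
  have "\<exists>z>t - 1. z < t \<and> F t - F (t - 1) = (t - (t - 1)) * f z"
    by (rule MVT2) (auto simp: t_def intro!: F')
  then obtain z where "z < t" "F t - F (t - 1) = f z" by auto
  then have "\<bar>f z\<bar> < \<bar>c\<bar> / 2" "\<bar>f z - c\<bar> < \<bar>c\<bar> / 2"
    using a[of t] b[of z] by (simp_all add: t_def)
  then show False by linarith
qed

text \<open>
  The quotient \<open>h / p\<close> has derivative zero off \<open>K\<close>; continuity across the finitely many points of
  \<open>K\<close> prevents the constant from changing there.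
\<close>

lemma log_derivative_equation_unique:
  fixes p h :: "real \<Rightarrow> real"
  assumes I: "connected I" "open I" and K: "finite K"
    and p: "continuous_on I p" "\<And>x. x \<in> I \<Longrightarrow> 0 < p x" and h: "continuous_on I h"
    and p': "\<And>x. x \<in> I - K \<Longrightarrow> (p has_real_derivative p' x) (at x)"
    and h': "\<And>x. x \<in> I - K \<Longrightarrow> (h has_real_derivative p' x / p x * h x) (at x)"
  obtains c where "\<And>x. x \<in> I \<Longrightarrow> h x = c * p x"
proof -
  have p0: "p x \<noteq> 0" if "x \<in> I" for x using p(2)[OF that] by simp
  have "continuous_on I (\<lambda>x. h x / p x)"
    using p(1) h p0 by (intro continuous_on_divide) auto
  moreover have "((\<lambda>x. h x / p x) has_real_derivative 0) (at x)" if x: "x \<in> I - K" for x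
    using DERIV_divide[OF h'[OF x] p'[OF x]] p0 x by simp
  ultimately have "(\<lambda>x. h x / p x) constant_on I"
    using DERIV_zero_connected_constant_on[OF I K] by blast
  then obtain c where "\<And>x. x \<in> I \<Longrightarrow> h x / p x = c"
    unfolding constant_on_def by blast
  then show thesis
    using that[of c] p0 by (simp add: field_simps)
qed

lemma cdf_density_has_derivative:
  fixes p :: "real \<Rightarrow> real"
  assumes p: "prob_density p" and cont: "isCont p s"
  shows "(cdf (density lborel (\<lambda>x. ennreal (p x))) has_real_derivative p s) (at s)"
proof -
  have [measurable]: "p \<in> borel_measurable borel" and pos: "\<And>x. 0 \<le> p x"
    and total: "(\<integral>\<^sup>+ x. ennreal (p x) \<partial>lborel) = 1"
    using p by (auto simp: prob_density_def)
  have int: "integrable lborel p"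
    by (rule integrableI_nonneg) (auto simp: pos total)
  have "cdf (density lborel (\<lambda>x. ennreal (p x))) = (\<lambda>t. \<integral>x. p x * indicator {..t} x \<partial>lborel)"
  proof
    fix t
    have "cdf (density lborel (\<lambda>x. ennreal (p x))) t
        = (\<integral>x. indicator {..t} x \<partial>density lborel (\<lambda>x. ennreal (p x)))"
      by (simp add: cdf_def)
    also have "\<dots> = (\<integral>x. p x *\<^sub>R indicator {..t} x \<partial>lborel)"
      by (rule integral_density) (auto simp: pos)
    finally show "cdf (density lborel (\<lambda>x. ennreal (p x))) t = (\<integral>x. p x * indicator {..t} x \<partial>lborel)"
      by simp
  qed
  moreover have "((\<lambda>t. \<integral>x. p x * indicator {..t} x \<partial>lborel) has_real_derivative p s * 1) (at s)"
  proof (rule truncated_integral_has_derivative[where F="\<lambda>x. x"])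
    show "emeasure lborel {w \<in> space lborel. a < w \<and> w \<le> b} = ennreal (b - a)"
      if "a \<le> b" for a b :: real
      using emeasure_lborel_Ioc[OF that] by (simp add: greaterThanAtMost_def greaterThan_def atMost_def Int_def)
  qed (use int cont in \<open>auto simp: mono_def\<close>)
  ultimately show ?thesis by simp
qed

section \<open>The characterization\<close>

theorem corollary5p18:
  fixes R :: real and p :: "real \<Rightarrow> real" and m :: nat and y :: "nat \<Rightarrow> real"
    and M :: "'a measure" and X :: "'a \<Rightarrow> real"
  defines "S \<equiv> reg_set R m y"
  assumes p_density: "prob_density p"
    and p_support: "density_support p = {..R}"
    and i_cont: "continuous_on {..<R} p"
    and i_pos: "\<forall>x<R. p x > 0"
    and i_points: "strict_mono_on {1..m} y" "\<forall>i\<in>{1..m}. y i < R"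
    and i_C1: "\<forall>C\<in>components S. p C1_differentiable_on C"
    and ii: "bdd_above ((\<lambda>x. \<bar>deriv p x * min (dens_cdf p x) (1 - dens_cdf p x) / (p x)\<^sup>2\<bar>) ` S)"
    and iii: "(\<integral>\<^sup>+ x\<in>S. ennreal ((1 + \<bar>x\<bar>) * \<bar>deriv p x\<bar>) \<partial>lborel) < \<infinity>"
    and iv: "((\<lambda>x. (1 - dens_cdf p x) / p x) \<longlongrightarrow> 0) (at_left R)"
    and M: "prob_space M"
    and X_rv: "X \<in> borel_measurable M"
    and X_range: "\<forall>\<omega>\<in>space M. X \<omega> < R"
    and X_S: "measure M {\<omega> \<in> space M. X \<omega> \<in> S} = 1"
    and X_int1: "integrable M (\<lambda>\<omega>. deriv p (X \<omega>) / p (X \<omega>))"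
    and X_int2: "integrable M (\<lambda>\<omega>. deriv p (X \<omega>) / p (X \<omega>) * X \<omega>)"
  shows "distributed M lborel X (\<lambda>x. ennreal (p x)) \<longleftrightarrow>
    (\<forall>t<R. 1 - cdf (distr M borel X) t =
       (\<integral>\<omega>. deriv p (X \<omega>) / p (X \<omega>) * (R - max (X \<omega>) t) \<partial>M))"
proof -
  interpret prob_space M by (rule M)
  define \<nu> where "\<nu> = density lborel (\<lambda>x. ennreal (p x))"
  define \<mu> where "\<mu> = distr M borel X"
  define g where "g x = deriv p x / p x" for x
  define F where "F = cdf \<mu>"
  define P where "P = cdf \<nu>"
  define h where "h t = (\<integral>\<omega>. g (X \<omega>) * indicator {..t} (X \<omega>) \<partial>M)" for t
  define V where "V t = (\<integral>\<omega>. g (X \<omega>) * (R - max (X \<omega>) t) \<partial>M)" for t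
  note X_rv [measurable]
  have [measurable]: "p \<in> borel_measurable borel"
    and p_total: "(\<integral>\<^sup>+ x. ennreal (p x) \<partial>lborel) = 1"
    using p_density by (auto simp: prob_density_def)
  interpret \<mu>: real_distribution \<mu>
    unfolding \<mu>_def by (rule real_distribution_distr) (rule X_rv)
  have "prob_space \<nu>"
    by (rule prob_spaceI) (simp add: \<nu>_def emeasure_density p_total)
  then interpret \<nu>: real_distribution \<nu>
    by (simp add: real_distribution_def real_distribution_axioms_def \<nu>_def)

  have S: "S = {..<R} - y ` {1..m}" by (simp add: S_def reg_set_def)
  have fin: "finite (y ` {1..m})" by simp
  have openS: "open S" unfolding S by (intro open_Diff finite_imp_closed fin) simp
  have cont_p: "isCont p s" if "s < R" for s
    using i_cont that by (simp add: continuous_on_eq_continuous_at)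
  have p_pos: "0 < p s" if "s < R" for s using i_pos that by simp
  have p': "(p has_real_derivative deriv p s) (at s)" if "s \<in> S" for s
    by (rule deriv_C1_on_components(1)[OF openS i_C1 that])
  have cont_g: "isCont g s" if "s \<in> S" for s
    unfolding g_def using deriv_C1_on_components(2)[OF openS i_C1 that] that p_pos[of s] cont_p[of s]
    by (intro continuous_divide) (auto simp: S)

  have int_g: "integrable M (\<lambda>\<omega>. g (X \<omega>))" and int_gX: "integrable M (\<lambda>\<omega>. g (X \<omega>) * X \<omega>)"
    using X_int1 X_int2 by (simp_all add: g_def)

  have F_end: "F t = 1" if "R \<le> t" for t
  proof -
    have "X -` {..t} \<inter> space M = space M" using X_range that by (force intro: less_imp_le)
    then show ?thesis by (simp add: F_def \<mu>_def cdf_def measure_distr prob_space)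
  qed
  have P_end: "P t = 1" if "R \<le> t" for t
  proof -
    have "x \<le> t" if "0 < p x" for x
    proof -
      have "x \<in> density_support p"
        unfolding density_support_def using that by (intro subsetD[OF closure_subset]) simp
      then show ?thesis using p_support \<open>R \<le> t\<close> by simp
    qed
    then have "AE x in \<nu>. x \<in> {..t}"
      unfolding \<nu>_def by (subst AE_density) auto
    then have "\<nu>.prob {..t} = 1" by (subst \<nu>.prob_eq_1) auto
    then show ?thesis by (simp add: P_def cdf_def)
  qed
  have V_end: "V R = 0"
  proof -
    have "V R = (\<integral>\<omega>. 0 \<partial>M)"
      unfolding V_def using X_range by (intro Bochner_Integration.integral_cong) (auto simp: max_def)
    then show ?thesis by simp
  qed
  have P': "(P has_real_derivative p s) (at s)" if "s < R" for s
    unfolding P_def \<nu>_def by (rule cdf_density_has_derivative[OF p_density cont_p[OF that]])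
  have cont_P: "isCont P s" for s
  proof -
    have "AE x in \<nu>. x \<notin> {s}"
      unfolding \<nu>_def using AE_lborel_singleton[of s] by (subst AE_density) auto
    then have "\<nu>.prob {s} = 0" by (subst \<nu>.prob_eq_0) auto
    then show ?thesis unfolding P_def \<nu>.isCont_cdf .
  qed
  have cont_V: "isCont V s" for s
    unfolding V_def by (rule max_integral_continuous[OF X_rv int_g int_gX])

  \<comment> \<open>An atom of the law of \<open>X\<close> would be a jump of \<open>F\<close>, so continuity of \<open>F\<close> at \<open>s\<close> is the
    form in which absence of atoms is available in both directions of the equivalence.\<close>
  have no_atom: "AE \<omega> in M. X \<omega> \<noteq> s" if "isCont F s" for s
  proof -
    have "\<mu>.prob {s} = 0" using that unfolding F_def \<mu>.isCont_cdf .
    then have "AE x in \<mu>. x \<noteq> s" by (subst (asm) \<mu>.prob_eq_0) auto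
    then show ?thesis unfolding \<mu>_def by (subst (asm) AE_distr_iff) auto
  qed
  have V': "(V has_real_derivative - h s) (at s)" if "isCont F s" for s
    unfolding V_def h_def by (rule max_integral_has_derivative[OF X_rv int_g int_gX no_atom[OF that]])
  have cont_h: "isCont h s" if "isCont F s" for s
    unfolding h_def by (rule truncated_integral_continuous[OF X_rv int_g no_atom[OF that]])
  have h_bot: "(h \<longlongrightarrow> 0) at_bot"
    unfolding h_def by (rule truncated_integral_at_bot[OF X_rv int_g])
  \<comment> \<open>The measure of \<open>{a<..b}\<close> under the law of \<open>X\<close> is \<open>F b - F a\<close>, so this is the relation
    \<open>dh = g dF\<close> wherever \<open>F\<close> is differentiable.\<close>
  have h': "(h has_real_derivative g s * D) (at s)"
    if "s \<in> S" "(F has_real_derivative D) (at s)" for s D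
    unfolding h_def
  proof (rule truncated_integral_has_derivative[OF X_rv int_g _ _ cont_g[OF that(1)] that(2)])
    show "mono F" unfolding F_def by (intro monoI \<mu>.cdf_nondecreasing)
    fix a b :: real assume "a \<le> b"
    have "emeasure M {\<omega> \<in> space M. a < X \<omega> \<and> X \<omega> \<le> b} = emeasure \<mu> {a<..b}"
      unfolding \<mu>_def by (subst emeasure_distr) (auto intro!: arg_cong[where f="emeasure M"])
    then show "emeasure M {\<omega> \<in> space M. a < X \<omega> \<and> X \<omega> \<le> b} = ennreal (F b - F a)"
      using \<mu>.emeasure_Ioc[OF \<open>a \<le> b\<close>] by (simp add: F_def)
  qed

  have dist_iff: "distributed M lborel X (\<lambda>x. ennreal (p x)) \<longleftrightarrow> \<mu> = \<nu>"
  proof -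
    have "distr M lborel X = \<mu>" unfolding \<mu>_def by (rule distr_cong) auto
    then show ?thesis by (simp add: distributed_def \<nu>_def)
  qed
  have "\<mu> = \<nu> \<longleftrightarrow> (\<forall>t<R. 1 - F t = V t)"
  proof
    assume "\<mu> = \<nu>"
    then have FP: "F = P" by (simp add: F_def P_def)
    \<comment> \<open>Here \<open>F' = p\<close>, and \<open>dh = g dF\<close> becomes \<open>h' = (p' / p) p = p'\<close> off the points \<open>y i\<close>.\<close>
    have "(\<lambda>x. h x - p x) constant_on {..<R}"
    proof (rule DERIV_zero_connected_constant_on[OF _ _ fin])
      show "continuous_on {..<R} (\<lambda>x. h x - p x)"
        using cont_h cont_p cont_P
        by (intro continuous_at_imp_continuous_on ballI continuous_diff) (auto simp: FP)
      show "\<forall>x\<in>{..<R} - y ` {1..m}. ((\<lambda>x. h x - p x) has_real_derivative 0) (at x)"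
      proof
        fix x assume "x \<in> {..<R} - y ` {1..m}"
        then have x: "x \<in> S" "x < R" by (auto simp: S)
        then have "(h has_real_derivative g x * p x) (at x)"
          using P'[of x] by (intro h') (simp_all add: FP)
        from DERIV_diff[OF this p'[OF x(1)]] show "((\<lambda>x. h x - p x) has_real_derivative 0) (at x)"
          using p_pos[OF x(2)] by (simp add: g_def)
      qed
    qed auto
    then obtain c where c: "\<And>x. x < R \<Longrightarrow> h x - p x = c"
      unfolding constant_on_def by auto
    \<comment> \<open>Since \<open>h\<close> vanishes at \<open>-\<infinity>\<close>, \<open>p\<close> tends to \<open>-c\<close> there, and a probability density can only
    tend to \<open>0\<close>.\<close>
    have "((\<lambda>x. h x - c) \<longlongrightarrow> 0 - c) at_bot"
      using h_bot by (intro tendsto_diff tendsto_const)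
    moreover have "\<forall>\<^sub>F x in at_bot. h x - c = p x"
      using eventually_gt_at_bot[of R] by eventually_elim (simp add: algebra_simps flip: c)
    ultimately have "(p \<longlongrightarrow> 0 - c) at_bot"
      by (rule Lim_transform_eventually)
    then have "0 - c = 0"
      using derivative_limit_at_bot_eq_0[OF P' \<nu>.cdf_lim_at_bot[folded P_def]] by blast
    then have hp: "h x = p x" if "x < R" for x using c[OF that] by simp
    show "\<forall>t<R. 1 - F t = V t"
    proof (intro allI impI)
      fix t assume "t < R"
      \<comment> \<open>Both \<open>V\<close> and \<open>1 - F\<close> vanish at \<open>R\<close> and have derivative \<open>-p\<close> to its left.\<close>
      have "V R + F R = V t + F t"
      proof (rule DERIV_isconst_end[OF \<open>t < R\<close>])
        show "continuous_on {t..R} (\<lambda>x. V x + F x)"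
          using cont_V cont_P by (intro continuous_at_imp_continuous_on ballI continuous_add) (auto simp: FP)
        show "((\<lambda>x. V x + F x) has_real_derivative 0) (at x)" if "t < x" "x < R" for x
          using DERIV_add[OF V'[of x] P'[OF that(2)]] cont_P hp[OF that(2)] by (simp add: FP)
      qed
      then show "1 - F t = V t" using V_end F_end[of R] by simp
    qed
  next
    assume id: "\<forall>t<R. 1 - F t = V t"
    have FV: "F t = 1 - V t" if "t \<le> R" for t
      using id that V_end F_end[of R] by (cases "t = R") (auto simp: algebra_simps)
    \<comment> \<open>The identity first yields continuity of \<open>F\<close>, hence no atoms, and only then that \<open>V\<close>, and
    with it \<open>F\<close>, is differentiable.\<close>
    have near: "\<forall>\<^sub>F t in nhds s. F t = 1 - V t" if "s < R" for s
      using eventually_nhds_in_open[of "{..<R}" s] that FV by (auto elim!: eventually_mono)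
    have cont_F: "isCont F s" if "s < R" for s
      using cont_V by (subst isCont_cong[OF near[OF that]]) (intro continuous_diff continuous_const)
    have F': "(F has_real_derivative h s) (at s)" if "s < R" for s
      using DERIV_diff[OF DERIV_const V'[OF cont_F[OF that]]]
      by (subst DERIV_cong_ev[OF refl near[OF that] refl]) simp
    \<comment> \<open>With \<open>F' = h\<close>, \<open>dh = g dF\<close> becomes the linear equation \<open>h' = (p' / p) h\<close>.\<close>
    obtain c where c: "\<And>x. x \<in> {..<R} \<Longrightarrow> h x = c * p x"
    proof (rule log_derivative_equation_unique[of "{..<R}" "y ` {1..m}" p h "deriv p"])
      show "continuous_on {..<R} h"
        using cont_h cont_F by (intro continuous_at_imp_continuous_on) auto
      show "(h has_real_derivative deriv p x / p x * h x) (at x)" if "x \<in> {..<R} - y ` {1..m}" for x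
        using h'[OF _ F'[of x]] that by (simp add: S g_def)
    qed (use i_cont p_pos p' in \<open>auto simp: S\<close>)
    \<comment> \<open>\<open>F\<close> and \<open>c P\<close> have the same derivative; comparing them at \<open>R\<close>, where both distribution
    functions are \<open>1\<close>, and at \<open>-\<infinity>\<close>, where both vanish, forces \<open>c = 1\<close>.\<close>
    have const: "F t - c * P t = 1 - c" if "t < R" for t
    proof -
      have "F R - c * P R = F t - c * P t"
      proof (rule DERIV_isconst_end[OF that])
        have "continuous_on {t..R} (\<lambda>x. (1 - V x) - c * P x)"
          using cont_V cont_P by (intro continuous_at_imp_continuous_on ballI continuous_intros) auto
        then show "continuous_on {t..R} (\<lambda>x. F x - c * P x)"
          by (rule continuous_on_eq) (simp add: FV)
        show "((\<lambda>x. F x - c * P x) has_real_derivative 0) (at x)" if "t < x" "x < R" for x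
          using DERIV_diff[OF F'[OF that(2)] DERIV_cmult[OF P'[OF that(2)], of c]] c[of x] that by simp
      qed
      then show ?thesis using F_end[of R] P_end[of R] by simp
    qed
    have "((\<lambda>t. F t - c * P t) \<longlongrightarrow> 0 - c * 0) at_bot"
      unfolding F_def P_def by (intro tendsto_intros \<mu>.cdf_lim_at_bot \<nu>.cdf_lim_at_bot)
    moreover have "\<forall>\<^sub>F t in at_bot. F t - c * P t = 1 - c"
      using eventually_gt_at_bot[of R] by eventually_elim (rule const)
    ultimately have "((\<lambda>t::real. 1 - c) \<longlongrightarrow> 0 - c * 0) at_bot"
      by (rule Lim_transform_eventually)
    then have "c = 1" by (simp add: tendsto_const_iff)
    then have "F t = P t" for t
      using const[of t] F_end[of t] P_end[of t] by (cases "t < R") auto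
    then have "cdf \<mu> = cdf \<nu>" by (auto simp: F_def P_def)
    then show "\<mu> = \<nu>"
      by (rule cdf_unique[OF \<mu>.real_distribution_axioms \<nu>.real_distribution_axioms])
  qed
  then show ?thesis
    unfolding dist_iff by (simp add: F_def \<mu>_def V_def g_def)
qed

end
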